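(* Let $n\ge 1$. A Dyck path $P\in D_n$ is a regular element of the Heyting algebra $D_n$ (i.e. $P=\ \sim\sim\! P$) if and only if all the factors of $P$ are pyramids.
   Context: A Dyck path of semilength $n$ is a lattice path from $(0,0)$ to $(2n,0)$ using steps $u=(1,1)$ and $d=(1,-1)$ and never going below the $x$-axis. $D_n$ is the set of Dyck paths of semilength $n$, ordered by $P\le Q$ iff $P$ lies weakly below $Q$; it is a finite distributive lattice with minimum $0=(ud)^n$, hence a Heyting algebra with relative pseudocomplement $P\rightsquigarrow Q=\bigvee\{Z\in D_n : P\wedge Z\le Q\}$ and pseudocomplement $\sim\! P=P\rightsquigarrow 0$. A factor of a Dyck path is a minimal nonempty subsequence of consecutive steps starting and ending on the $x$-axis; every Dyck path is uniquely the concatenation of its factors. A pyramid is a subsequence of consecutive steps of the form $u^kd^k$ ($k\ge 1$) starting and ending on the $x$-axis. *)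

theory Defs
  imports "HOL-Algebra.Lattice"
begin

datatype step = Up | Down

fun rise :: "step \<Rightarrow> int" where
  "rise Up = 1"
| "rise Down = - 1"

text \<open>The point of the path with abscissa \<open>i\<close> is \<open>(i, height P i)\<close>, for \<open>i \<le> length P\<close>.\<close>

definition height :: "step list \<Rightarrow> nat \<Rightarrow> int" where
  "height P i = (\<Sum>s\<leftarrow>take i P. rise s)"

definition dyck_paths :: "nat \<Rightarrow> step list set" where
  "dyck_paths n = {P. length P = 2 * n \<and> height P (2 * n) = 0 \<and> (\<forall>i\<le>2 * n. 0 \<le> height P i)}"

definition weakly_below :: "step list \<Rightarrow> step list \<Rightarrow> bool" where
  "weakly_below P Q \<longleftrightarrow> (\<forall>i\<le>length P. height P i \<le> height Q i)"

definition dyck_lattice :: "nat \<Rightarrow> step list gorder" where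
  "dyck_lattice n = \<lparr>carrier = dyck_paths n, eq = (=), le = weakly_below\<rparr>"

text \<open>
  Heyting algebra operations of a bounded lattice. They are meaningful when the joins below are
  greatest elements of the respective sets, as in every finite distributive lattice.
\<close>

definition rel_pseudocomplement :: "('a, 'b) gorder_scheme \<Rightarrow> 'a \<Rightarrow> 'a \<Rightarrow> 'a" where
  "rel_pseudocomplement L x y = \<Squnion>\<^bsub>L\<^esub> {z \<in> carrier L. x \<sqinter>\<^bsub>L\<^esub> z \<sqsubseteq>\<^bsub>L\<^esub> y}"

definition pseudocomplement :: "('a, 'b) gorder_scheme \<Rightarrow> 'a \<Rightarrow> 'a" where
  "pseudocomplement L x = rel_pseudocomplement L x \<bottom>\<^bsub>L\<^esub>"

definition regular_element :: "('a, 'b) gorder_scheme \<Rightarrow> 'a \<Rightarrow> bool" where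
  "regular_element L x \<longleftrightarrow> x \<in> carrier L \<and> x = pseudocomplement L (pseudocomplement L x)"

text \<open>
  A subsequence of consecutive steps is given by its end positions \<open>i < j\<close>, so that equal step
  sequences occurring at different places of \<open>P\<close> are distinguished and its end points can be
  required to lie on the axis.
\<close>

definition steps_between :: "step list \<Rightarrow> nat \<Rightarrow> nat \<Rightarrow> step list" where
  "steps_between P i j = take (j - i) (drop i P)"

definition axis_to_axis :: "step list \<Rightarrow> nat \<Rightarrow> nat \<Rightarrow> bool" where
  "axis_to_axis P i j \<longleftrightarrow> i < j \<and> j \<le> length P \<and> height P i = 0 \<and> height P j = 0"

definition is_factor :: "step list \<Rightarrow> nat \<Rightarrow> nat \<Rightarrow> bool" where
  "is_factor P i j \<longleftrightarrow> axis_to_axis P i j \<and>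
     (\<forall>i' j'. axis_to_axis P i' j' \<and> i \<le> i' \<and> j' \<le> j \<longrightarrow> i' = i \<and> j' = j)"

definition is_pyramid :: "step list \<Rightarrow> nat \<Rightarrow> nat \<Rightarrow> bool" where
  "is_pyramid P i j \<longleftrightarrow> axis_to_axis P i j \<and>
     (\<exists>k\<ge>1. steps_between P i j = replicate k Up @ replicate k Down)"

text \<open>
  The remainder shows that the meets and the bottom element used above exist in \<open>dyck_lattice n\<close>
  and that the bottom element is the path \<open>(ud)\<^sup>n\<close>.
\<close>

lemma height_0 [simp]: "height P 0 = 0"
  by (simp add: height_def)

lemma height_Suc: "i < length P \<Longrightarrow> height P (Suc i) = height P i + rise (P ! i)"
  by (simp add: height_def take_Suc_conv_app_nth)

lemma rise_cases: "rise s = 1 \<or> rise s = - 1"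
  by (cases s) auto

lemma even_height: "i \<le> length P \<Longrightarrow> even (height P i + int i)"
proof (induction i)
  case (Suc i)
  then show ?case using rise_cases[of "P ! i"] by (auto simp: height_Suc)
qed simp

lemma height_eqI:
  assumes "length P = length Q" "\<And>i. i \<le> length P \<Longrightarrow> height P i = height Q i"
  shows "P = Q"
proof (rule nth_equalityI)
  fix i assume i: "i < length P"
  then have "rise (P ! i) = rise (Q ! i)"
    using assms(1) assms(2)[of i] assms(2)[of "Suc i"] by (simp add: height_Suc)
  then show "P ! i = Q ! i" by (cases "P ! i"; cases "Q ! i") auto
qed (fact assms(1))

lemma path_with_heights:
  assumes "h 0 = 0" "\<And>i. i < m \<Longrightarrow> h (Suc i) = h i + 1 \<or> h (Suc i) = h i - (1::int)"
  shows "\<exists>P. length P = m \<and> (\<forall>i\<le>m. height P i = h i)"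
proof -
  define P where "P = map (\<lambda>i. if h (Suc i) = h i + 1 then Up else Down) [0..<m]"
  have len: "length P = m" by (simp add: P_def)
  have "height P i = h i" if "i \<le> m" for i
    using that
  proof (induction i)
    case (Suc i)
    then have "P ! i = (if h (Suc i) = h i + 1 then Up else Down)" by (simp add: P_def)
    then show ?case using Suc assms(2)[of i] by (auto simp: height_Suc len)
  qed (use assms in simp)
  with len show ?thesis by blast
qed

lemma height_steps:
  assumes "length P = m" "length Q = m" "i < m"
  shows "max (height P (Suc i)) (height Q (Suc i)) = max (height P i) (height Q i) + 1 \<or>
         max (height P (Suc i)) (height Q (Suc i)) = max (height P i) (height Q i) - 1"
    and "min (height P (Suc i)) (height Q (Suc i)) = min (height P i) (height Q i) + 1 \<or>
         min (height P (Suc i)) (height Q (Suc i)) = min (height P i) (height Q i) - 1"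
proof -
  have "even ((height P i + int i) - (height Q i + int i))"
    using assms even_height[of i P] even_height[of i Q] by (intro dvd_diff) auto
  then have "height P i = height Q i \<or> height P i \<ge> height Q i + 2 \<or> height Q i \<ge> height P i + 2"
    by (simp only: add_diff_cancel_right) presburger
  then show "max (height P (Suc i)) (height Q (Suc i)) = max (height P i) (height Q i) + 1 \<or>
         max (height P (Suc i)) (height Q (Suc i)) = max (height P i) (height Q i) - 1"
    and "min (height P (Suc i)) (height Q (Suc i)) = min (height P i) (height Q i) + 1 \<or>
         min (height P (Suc i)) (height Q (Suc i)) = min (height P i) (height Q i) - 1"
    using assms rise_cases[of "P ! i"] rise_cases[of "Q ! i"] by (auto simp: height_Suc)
qed

lemma lattice_dyck_lattice: "lattice (dyck_lattice n)"
proof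
  fix P Q assume "P \<in> carrier (dyck_lattice n)" "Q \<in> carrier (dyck_lattice n)"
  then have PQ: "P \<in> dyck_paths n" "Q \<in> dyck_paths n" by (simp_all add: dyck_lattice_def)
  then have len: "length P = 2 * n" "length Q = 2 * n" by (auto simp: dyck_paths_def)
  obtain J where "length J = 2 * n" "\<forall>i\<le>2 * n. height J i = max (height P i) (height Q i)"
    using path_with_heights[of "\<lambda>i. max (height P i) (height Q i)" "2 * n"] height_steps(1)[OF len]
    by auto
  with PQ have "least (dyck_lattice n) J (Upper (dyck_lattice n) {P, Q})"
    by (auto simp: least_def Upper_def dyck_lattice_def weakly_below_def dyck_paths_def max_def)
  then show "\<exists>s. least (dyck_lattice n) s (Upper (dyck_lattice n) {P, Q})" by blast
  obtain M where "length M = 2 * n" "\<forall>i\<le>2 * n. height M i = min (height P i) (height Q i)"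
    using path_with_heights[of "\<lambda>i. min (height P i) (height Q i)" "2 * n"] height_steps(2)[OF len]
    by auto
  with PQ have "greatest (dyck_lattice n) M (Lower (dyck_lattice n) {P, Q})"
    by (auto simp: greatest_def Lower_def dyck_lattice_def weakly_below_def dyck_paths_def min_def)
  then show "\<exists>s. greatest (dyck_lattice n) s (Lower (dyck_lattice n) {P, Q})" by blast
next
  fix P Q assume "P \<sqsubseteq>\<^bsub>dyck_lattice n\<^esub> Q" "Q \<sqsubseteq>\<^bsub>dyck_lattice n\<^esub> P"
    "P \<in> carrier (dyck_lattice n)" "Q \<in> carrier (dyck_lattice n)"
  then show "P .=\<^bsub>dyck_lattice n\<^esub> Q"
    by (auto simp: dyck_lattice_def weakly_below_def dyck_paths_def intro!: height_eqI order.antisym)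
next
  fix P Q R assume "P \<sqsubseteq>\<^bsub>dyck_lattice n\<^esub> Q" "Q \<sqsubseteq>\<^bsub>dyck_lattice n\<^esub> R"
    "P \<in> carrier (dyck_lattice n)" "Q \<in> carrier (dyck_lattice n)"
  then show "P \<sqsubseteq>\<^bsub>dyck_lattice n\<^esub> R"
    by (fastforce simp: dyck_lattice_def weakly_below_def dyck_paths_def)
qed (auto simp: dyck_lattice_def weakly_below_def)

lemma height_zigzag:
  "i \<le> 2 * n \<Longrightarrow> height (concat (replicate n [Up, Down])) i = int (i mod 2)"
proof (induction n arbitrary: i)
  case (Suc n)
  show ?case
  proof (cases "i < 2")
    case True
    then have "i = 0 \<or> i = 1" by auto
    then show ?thesis by (auto simp: height_def)
  next
    case False
    then obtain k where i: "i = Suc (Suc k)" by (metis add_2_eq_Suc le_Suc_ex not_less)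
    then have "height (concat (replicate (Suc n) [Up, Down])) i
        = height (concat (replicate n [Up, Down])) k"
      by (simp add: height_def)
    then show ?thesis using Suc i by simp
  qed
qed simp

lemma bottom_dyck_lattice: "\<bottom>\<^bsub>dyck_lattice n\<^esub> = concat (replicate n [Up, Down])"
proof -
  interpret lattice "dyck_lattice n" by (rule lattice_dyck_lattice)
  let ?Z = "concat (replicate n [Up, Down])"
  have len: "length ?Z = 2 * n" by (induction n) auto
  then have Z: "?Z \<in> dyck_paths n" by (simp add: dyck_paths_def height_zigzag)
  have "height ?Z i \<le> height P i" if P: "P \<in> dyck_paths n" and i: "i \<le> 2 * n" for P i
  proof -
    have "height P i \<ge> 0" "even (height P i + int i)"
      using P i even_height[of i P] by (auto simp: dyck_paths_def)
    then have "int (i mod 2) \<le> height P i" by presburger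
    then show ?thesis using i by (simp add: height_zigzag)
  qed
  with Z len have least: "least (dyck_lattice n) ?Z (carrier (dyck_lattice n))"
    by (auto simp: least_def dyck_lattice_def weakly_below_def)
  show ?thesis
    unfolding bottom_def by (rule some_equality[where P = "\<lambda>x. least (dyck_lattice n) x (carrier (dyck_lattice n))"]) (use least least_unique in blast)+
qed

end

(*
  The meet of P and Q is the minimum (ud)^n iff at every even abscissa P or Q is on the axis. Among
  the paths meeting the axis at all points of a set S, which contains 0 and 2n, there is a
  greatest one: its height at i is the distance from i to S, and it meets the axis exactly in S.
  Hence, if P meets the axis in Z, the pseudocomplement of P is the distance function to the set of
  even numbers outside Z together with 0 and 2n, and taking the pseudocomplement again gives the
  distance function to Z. So P is regular iff its height is the distance to its own zeros, which
  between two consecutive zeros is the shape of a pyramid.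
*)
theory Submission
  imports Defs
begin

section \<open>Heights, factors and pyramids\<close>

definition zeros :: "step list \<Rightarrow> nat set" where
  "zeros P = {i. i \<le> length P \<and> height P i = 0}"

lemma finite_zeros: "finite (zeros P)"
  by (rule finite_subset[of _ "{..length P}"]) (auto simp: zeros_def)

lemma even_zeros: "i \<in> zeros P \<Longrightarrow> even i"
  using even_height[of i P] by (auto simp: zeros_def)

lemma ends_in_zeros: "P \<in> dyck_paths n \<Longrightarrow> 0 \<in> zeros P \<and> 2 * n \<in> zeros P"
  by (auto simp: zeros_def dyck_paths_def)

lemma height_diff_le:
  assumes "i \<le> j" "j \<le> length P"
  shows "\<bar>height P j - height P i\<bar> \<le> int j - int i"
  using assms
proof (induction j rule: dec_induct)
  case (step j)
  then show ?case using rise_cases[of "P ! j"] by (auto simp: height_Suc)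
qed simp

text \<open>A step changes the height by one, so a path cannot climb higher than its distance from a
  point on the axis. This bound is what makes distance functions maximal.\<close>

lemma height_le_dist_zero:
  assumes "i \<le> length P" "s \<in> zeros P"
  shows "height P i \<le> \<bar>int i - int s\<bar>"
  using assms height_diff_le[of i s P] height_diff_le[of s i P]
  by (cases "i \<le> s") (auto simp: zeros_def)

lemma height_steps_between:
  assumes "a \<le> b" "b \<le> length P" "j \<le> b - a"
  shows "height (steps_between P a b) j = height P (a + j) - height P a"
  using assms by (simp add: height_def steps_between_def take_add min_def)

lemma height_pyramid:
  "j \<le> 2 * k \<Longrightarrow>
    height (replicate k Up @ replicate k Down) j = min (int j) (2 * int k - int j)"
  by (cases "j \<le> k") (auto simp: height_def min_def sum_list_replicate of_nat_diff)

text \<open>Step lists of equal length agree iff their heights do, so the word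
  \<open>u^k d^k\<close> can be replaced by its height profile: the distance to the nearer end of
  the segment.\<close>

lemma is_pyramid_iff_height:
  assumes "axis_to_axis P a b"
  shows "is_pyramid P a b \<longleftrightarrow>
    (\<forall>i. a \<le> i \<and> i \<le> b \<longrightarrow> height P i = min (int i - int a) (int b - int i))"
proof
  have ab: "a < b" "b \<le> length P" "height P a = 0" "height P b = 0"
    using assms by (auto simp: axis_to_axis_def)
  have len: "length (steps_between P a b) = b - a"
    using ab by (simp add: steps_between_def)
  have ht: "height (steps_between P a b) j = height P (a + j)" if "j \<le> b - a" for j
    using ab that by (simp add: height_steps_between)
  {
    assume "is_pyramid P a b"
    then obtain k where k: "steps_between P a b = replicate k Up @ replicate k Down"
      by (auto simp: is_pyramid_def)
    have ba: "b - a = 2 * k" using len k by simp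
    show "\<forall>i. a \<le> i \<and> i \<le> b \<longrightarrow> height P i = min (int i - int a) (int b - int i)"
    proof (intro allI impI)
      fix i assume i: "a \<le> i \<and> i \<le> b"
      then have "i - a \<le> b - a" "a + (i - a) = i" by auto
      then have "height P i = min (int (i - a)) (2 * int k - int (i - a))"
        using ht[of "i - a"] height_pyramid[of "i - a" k] unfolding ba k by metis
      moreover have "int (i - a) = int i - int a" "2 * int k = int b - int a"
        using i ab ba by linarith+
      ultimately show "height P i = min (int i - int a) (int b - int i)" by simp
    qed
  next
    assume R: "\<forall>i. a \<le> i \<and> i \<le> b \<longrightarrow> height P i = min (int i - int a) (int b - int i)"
    \<comment> \<open>The zeros of a path are even, so the length of the segment is even and its
      half is the \<open>k\<close> of the pyramid.\<close>
    have "even a" "even b" using ab by (auto intro!: even_zeros[of _ P] simp: zeros_def)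
    then obtain k where k: "b - a = 2 * k" by (meson dvd_diff_nat dvdE)
    have "steps_between P a b = replicate k Up @ replicate k Down"
    proof (rule height_eqI)
      fix j assume "j \<le> length (steps_between P a b)"
      then have j: "j \<le> b - a" by (simp add: len)
      then have "height P (a + j) = min (int j) (2 * int k - int j)"
        using R[rule_format, of "a + j"] ab k by auto
      then show "height (steps_between P a b) j = height (replicate k Up @ replicate k Down) j"
        using j k by (simp add: ht height_pyramid)
    qed (simp add: len k)
    moreover have "k \<ge> 1" using k ab by simp
    ultimately show "is_pyramid P a b" using assms by (auto simp: is_pyramid_def)
  }
qed

text \<open>An inner zero would cut off a shorter segment starting at \<open>a\<close>; conversely,
  the ends of a nested segment are zeros and so can only be \<open>a\<close> and
  \<open>b\<close>.\<close>

lemma is_factor_iff: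
  "is_factor P a b \<longleftrightarrow> axis_to_axis P a b \<and> zeros P \<inter> {a<..<b} = {}"
proof
  assume F: "is_factor P a b"
  then have ab: "axis_to_axis P a b" by (simp add: is_factor_def)
  moreover have "\<not> (a < i \<and> i < b)" if "i \<in> zeros P" for i
  proof
    assume "a < i \<and> i < b"
    moreover from this have "axis_to_axis P a i"
      using that ab by (auto simp: axis_to_axis_def zeros_def)
    ultimately show False
      using F unfolding is_factor_def by (metis less_irrefl less_imp_le order_refl)
  qed
  ultimately show "axis_to_axis P a b \<and> zeros P \<inter> {a<..<b} = {}" by auto
next
  assume *: "axis_to_axis P a b \<and> zeros P \<inter> {a<..<b} = {}"
  have "i = a \<and> j = b" if "axis_to_axis P i j" "a \<le> i" "j \<le> b" for i j
  proof -
    have "i \<in> zeros P" "j \<in> zeros P" "i < j" using that by (auto simp: axis_to_axis_def zeros_def)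
    with * have "\<not> (a < i \<and> i < b)" "\<not> (a < j \<and> j < b)" by auto
    with \<open>i < j\<close> that show ?thesis by linarith
  qed
  with * show "is_factor P a b" unfolding is_factor_def by blast
qed

section \<open>The greatest path with prescribed zeros\<close>

text \<open>Taken in the integers to avoid truncated subtraction; meaningful for finite nonempty
  \<open>S\<close>, where the minimum exists.\<close>

definition dist_to :: "nat set \<Rightarrow> nat \<Rightarrow> int" where
  "dist_to S i = Min ((\<lambda>s. \<bar>int i - int s\<bar>) ` S)"

lemma dist_to_le: "finite S \<Longrightarrow> s \<in> S \<Longrightarrow> dist_to S i \<le> \<bar>int i - int s\<bar>"
  by (auto simp: dist_to_def)

lemma dist_to_attained:
  assumes "finite S" "S \<noteq> {}"
  obtains s where "s \<in> S" "dist_to S i = \<bar>int i - int s\<bar>"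
proof -
  have "dist_to S i \<in> (\<lambda>s. \<bar>int i - int s\<bar>) ` S"
    unfolding dist_to_def using assms by (intro Min_in) auto
  with that show ?thesis by auto
qed

lemma dist_to_eq_0_iff:
  assumes "finite S" "S \<noteq> {}"
  shows "dist_to S i = 0 \<longleftrightarrow> i \<in> S"
proof -
  obtain s where s: "s \<in> S" "dist_to S i = \<bar>int i - int s\<bar>"
    using dist_to_attained assms by blast
  then show ?thesis using dist_to_le[OF assms(1), of i i] by auto
qed

text \<open>The distance to a set changes by at most one from \<open>i\<close> to
  \<open>Suc i\<close>. It cannot stay constant, since for a set of even numbers it has the parity
  of \<open>i\<close>.\<close>

lemma dist_to_Suc:
  assumes "finite S" "S \<noteq> {}" "\<And>s. s \<in> S \<Longrightarrow> even s"
  shows "dist_to S (Suc i) = dist_to S i + 1 \<or> dist_to S (Suc i) = dist_to S i - 1"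
proof -
  obtain s where s: "s \<in> S" "dist_to S i = \<bar>int i - int s\<bar>"
    using dist_to_attained assms by blast
  obtain t where t: "t \<in> S" "dist_to S (Suc i) = \<bar>int (Suc i) - int t\<bar>"
    using dist_to_attained assms by blast
  \<comment> \<open>Each point is compared with the nearest element of the other one.\<close>
  have "dist_to S i \<le> \<bar>int i - int t\<bar>" "dist_to S (Suc i) \<le> \<bar>int (Suc i) - int s\<bar>"
    using s t assms(1) dist_to_le by metis+
  then have "\<bar>dist_to S (Suc i) - dist_to S i\<bar> \<le> 1" using s t by linarith
  moreover have "dist_to S (Suc i) \<noteq> dist_to S i"
  proof
    assume "dist_to S (Suc i) = dist_to S i"
    then have "\<bar>int (Suc i) - int t\<bar> = \<bar>int i - int s\<bar>" using s t by simp
    moreover have "even (int s)" "even (int t)" using s t assms by auto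
    ultimately show False by presburger
  qed
  ultimately show ?thesis by linarith
qed

lemma dist_to_path:
  assumes "S \<subseteq> {..2 * n}" "\<And>s. s \<in> S \<Longrightarrow> even s" "0 \<in> S" "2 * n \<in> S"
  obtains M where "M \<in> dyck_paths n" "\<And>i. i \<le> 2 * n \<Longrightarrow> height M i = dist_to S i"
proof -
  have fin: "finite S" "S \<noteq> {}" using assms finite_subset by auto
  have "dist_to S 0 = 0" using dist_to_eq_0_iff fin assms by blast
  with dist_to_Suc[OF fin] assms(2)
  obtain M where M: "length M = 2 * n" "\<forall>i\<le>2 * n. height M i = dist_to S i"
    using path_with_heights[of "dist_to S" "2 * n"] by blast
  have "dist_to S i \<ge> 0" for i
    using dist_to_attained[OF fin, of i] by (metis abs_ge_zero)
  with M dist_to_eq_0_iff[OF fin] assms have "M \<in> dyck_paths n" by (auto simp: dyck_paths_def)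
  with M that show ?thesis by blast
qed

text \<open>With \<open>dist_to_path\<close>, this makes the distance path the greatest Dyck path
  that touches the axis at all points of \<open>S\<close>.\<close>

lemma height_le_dist_to:
  assumes "i \<le> length P" "S \<subseteq> zeros P" "S \<noteq> {}"
  shows "height P i \<le> dist_to S i"
proof -
  have "finite S" using assms finite_zeros finite_subset by blast
  then obtain s where "s \<in> S" "dist_to S i = \<bar>int i - int s\<bar>"
    using dist_to_attained assms by blast
  then show ?thesis using height_le_dist_zero assms by auto
qed

lemma zeros_dist_to:
  assumes "M \<in> dyck_paths n" "\<And>i. i \<le> 2 * n \<Longrightarrow> height M i = dist_to S i"
    "S \<subseteq> {..2 * n}" "S \<noteq> {}"
  shows "zeros M = S"
proof -
  have "finite S" using assms finite_subset by blast
  then show ?thesis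
    using assms dist_to_eq_0_iff[of S] by (auto simp: zeros_def dyck_paths_def)
qed

text \<open>Between consecutive zeros \<open>a\<close> and \<open>b\<close> the nearest zero is
  \<open>a\<close> or \<open>b\<close>, so the distance to the zeros has exactly the profile of a
  pyramid there.\<close>

lemma height_eq_dist_to_zeros_iff:
  assumes P: "P \<in> dyck_paths n"
  shows "(\<forall>i\<le>2 * n. height P i = dist_to (zeros P) i) \<longleftrightarrow>
    (\<forall>i j. is_factor P i j \<longrightarrow> is_pyramid P i j)"
proof
  have len: "length P = 2 * n" using P by (simp add: dyck_paths_def)
  have ne: "zeros P \<noteq> {}" using ends_in_zeros[OF P] by auto
  {
    assume D: "\<forall>i\<le>2 * n. height P i = dist_to (zeros P) i"
    show "\<forall>a b. is_factor P a b \<longrightarrow> is_pyramid P a b"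
    proof (intro allI impI)
      fix a b assume "is_factor P a b"
      then have F: "axis_to_axis P a b" "zeros P \<inter> {a<..<b} = {}" by (auto simp: is_factor_iff)
      then have ab: "a \<in> zeros P" "b \<in> zeros P" "b \<le> 2 * n"
        by (auto simp: axis_to_axis_def zeros_def len)
      have "height P i = min (int i - int a) (int b - int i)" if i: "a \<le> i" "i \<le> b" for i
      proof -
        obtain s where s: "s \<in> zeros P" "dist_to (zeros P) i = \<bar>int i - int s\<bar>"
          using dist_to_attained finite_zeros ne by blast
        \<comment> \<open>A nearest zero outside the open interval bounds the distance from below by
          the pyramid profile; the two facts that follow bound it from above.\<close>
        have "s \<le> a \<or> b \<le> s" using s F by force
        moreover have "dist_to (zeros P) i \<le> \<bar>int i - int a\<bar>"
          "dist_to (zeros P) i \<le> \<bar>int i - int b\<bar>"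
          using ab by (auto intro: dist_to_le finite_zeros)
        moreover have "height P i = dist_to (zeros P) i" using D i ab by simp
        ultimately show ?thesis using i s(2) by linarith
      qed
      then show "is_pyramid P a b" using F by (simp add: is_pyramid_iff_height)
    qed
  next
    assume pyr: "\<forall>a b. is_factor P a b \<longrightarrow> is_pyramid P a b"
    show "\<forall>i\<le>2 * n. height P i = dist_to (zeros P) i"
    proof (intro allI impI)
      fix i assume i: "i \<le> 2 * n"
      \<comment> \<open>Only this direction depends on the pyramids; the opposite inequality holds
        for every path by \<open>height_le_dist_to\<close>.\<close>
      have "\<exists>s\<in>zeros P. \<bar>int i - int s\<bar> \<le> height P i"
      proof (cases "i \<in> zeros P")
        case True
        then show ?thesis by (intro bexI[of _ i]) (auto simp: zeros_def)
      next
        case False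
        \<comment> \<open>The zeros next to \<open>i\<close> on either side, which exist because
          \<open>0\<close> and \<open>2 * n\<close> are zeros, delimit the factor containing
          \<open>i\<close>.\<close>
        define a where "a = Max {s \<in> zeros P. s \<le> i}"
        define b where "b = Min {s \<in> zeros P. i \<le> s}"
        have fin: "finite {s \<in> zeros P. s \<le> i}" "finite {s \<in> zeros P. i \<le> s}"
          using finite_zeros by auto
        have "a \<in> {s \<in> zeros P. s \<le> i}" "b \<in> {s \<in> zeros P. i \<le> s}"
          unfolding a_def b_def using fin ends_in_zeros[OF P] i
          by (intro Max_in Min_in; auto)+
        with False have ab: "a \<in> zeros P" "b \<in> zeros P" "a < i" "i < b"
          by (auto simp: le_less)
        have "s \<le> a \<or> b \<le> s" if "s \<in> zeros P" for s
          using that fin le_cases[of s i] unfolding a_def b_def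
          by (metis (mono_tags, lifting) Max_ge Min_le mem_Collect_eq)
        then have "zeros P \<inter> {a<..<b} = {}" by force
        moreover have F: "axis_to_axis P a b" using ab by (auto simp: axis_to_axis_def zeros_def)
        ultimately have "is_pyramid P a b" using pyr by (simp add: is_factor_iff)
        then have "height P i = min (int i - int a) (int b - int i)"
          using ab by (simp add: is_pyramid_iff_height[OF F])
        moreover have "\<bar>int i - int a\<bar> = int i - int a" "\<bar>int i - int b\<bar> = int b - int i"
          using ab by auto
        ultimately show ?thesis using ab by (metis min_def order_refl)
      qed
      then have "dist_to (zeros P) i \<le> height P i"
        using dist_to_le[OF finite_zeros] by (meson order_trans)
      moreover have "height P i \<le> dist_to (zeros P) i"
        using i len ne by (intro height_le_dist_to) auto
      ultimately show "height P i = dist_to (zeros P) i" by simp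
    qed
  }
qed

section \<open>Pseudocomplements\<close>

lemma meet_dyck_lattice:
  assumes P: "P \<in> dyck_paths n" and Q: "Q \<in> dyck_paths n"
  shows "P \<sqinter>\<^bsub>dyck_lattice n\<^esub> Q \<in> dyck_paths n"
    and "i \<le> 2 * n \<Longrightarrow> height (P \<sqinter>\<^bsub>dyck_lattice n\<^esub> Q) i = min (height P i) (height Q i)"
proof -
  let ?L = "dyck_lattice n"
  interpret lattice ?L by (rule lattice_dyck_lattice)
  have len: "length P = 2 * n" "length Q = 2 * n" using P Q by (auto simp: dyck_paths_def)
  obtain M where M: "length M = 2 * n" "\<forall>i\<le>2 * n. height M i = min (height P i) (height Q i)"
    using path_with_heights[of "\<lambda>i. min (height P i) (height Q i)" "2 * n"] height_steps(2)[OF len]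
      P Q by (auto simp: dyck_paths_def)
  with P Q have gr: "greatest ?L M (Lower ?L {P, Q})" and MD: "M \<in> dyck_paths n"
    by (auto simp: greatest_def Lower_def dyck_lattice_def weakly_below_def dyck_paths_def min_def)
  \<comment> \<open>The meet is defined by choice; uniqueness of greatest lower bounds identifies it
    with the explicit path \<open>M\<close>.\<close>
  have "greatest ?L (P \<sqinter>\<^bsub>?L\<^esub> Q) (Lower ?L {P, Q})"
    unfolding meet_def by (rule inf_of_two_greatest) (use P Q in \<open>simp_all add: dyck_lattice_def\<close>)
  with gr have "P \<sqinter>\<^bsub>?L\<^esub> Q = M" by (metis greatest_unique)
  with M MD show "P \<sqinter>\<^bsub>?L\<^esub> Q \<in> dyck_paths n"
    and "i \<le> 2 * n \<Longrightarrow> height (P \<sqinter>\<^bsub>?L\<^esub> Q) i = min (height P i) (height Q i)" by auto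
qed

text \<open>The bottom path has height \<open>i mod 2\<close>, so only even abscissas constrain the
  meet: at an odd one, the next even abscissa already forces one of the two heights down to at most
  1.\<close>

lemma meet_le_bottom_iff:
  assumes P: "P \<in> dyck_paths n" and Q: "Q \<in> dyck_paths n"
  shows "P \<sqinter>\<^bsub>dyck_lattice n\<^esub> Q \<sqsubseteq>\<^bsub>dyck_lattice n\<^esub> \<bottom>\<^bsub>dyck_lattice n\<^esub> \<longleftrightarrow>
    {i. i \<le> 2 * n \<and> even i} \<subseteq> zeros P \<union> zeros Q"
proof -
  have len: "length P = 2 * n" "length Q = 2 * n" "length (P \<sqinter>\<^bsub>dyck_lattice n\<^esub> Q) = 2 * n"
    using meet_dyck_lattice(1)[OF P Q] P Q by (auto simp: dyck_paths_def)
  have le: "X \<sqsubseteq>\<^bsub>dyck_lattice n\<^esub> Y \<longleftrightarrow> weakly_below X Y" for X Y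
    by (simp add: dyck_lattice_def)
  have "P \<sqinter>\<^bsub>dyck_lattice n\<^esub> Q \<sqsubseteq>\<^bsub>dyck_lattice n\<^esub> \<bottom>\<^bsub>dyck_lattice n\<^esub> \<longleftrightarrow>
      (\<forall>i\<le>2 * n. min (height P i) (height Q i) \<le> int (i mod 2))"
    unfolding bottom_dyck_lattice le weakly_below_def
    using len by (auto simp: height_zigzag meet_dyck_lattice(2)[OF P Q])
  also have "\<dots> \<longleftrightarrow> (\<forall>i\<le>2 * n. even i \<longrightarrow> height P i = 0 \<or> height Q i = 0)"
  proof (intro iffI allI impI)
    fix i assume "\<forall>i\<le>2 * n. min (height P i) (height Q i) \<le> int (i mod 2)" "i \<le> 2 * n" "even i"
    then have "min (height P i) (height Q i) \<le> 0" by fastforce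
    moreover have "height P i \<ge> 0" "height Q i \<ge> 0"
      using P Q \<open>i \<le> 2 * n\<close> by (auto simp: dyck_paths_def)
    ultimately show "height P i = 0 \<or> height Q i = 0" by linarith
  next
    fix i assume *: "\<forall>i\<le>2 * n. even i \<longrightarrow> height P i = 0 \<or> height Q i = 0" "i \<le> 2 * n"
    show "min (height P i) (height Q i) \<le> int (i mod 2)"
    proof (cases "even i")
      case True
      then show ?thesis using * by (auto simp: min_def)
    next
      case False
      \<comment> \<open>An odd \<open>i\<close> differs from \<open>2 * n\<close>, so its successor
        is still an abscissa of the paths.\<close>
      then have i: "Suc i \<le> 2 * n" "even (Suc i)" using *(2) by (auto simp: Suc_le_eq le_less)
      with *(1) have "height P (Suc i) = 0 \<or> height Q (Suc i) = 0" by blast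
      then have "height P i \<le> 1 \<or> height Q i \<le> 1"
        using i len height_diff_le[of i "Suc i" P] height_diff_le[of i "Suc i" Q] by auto
      then show ?thesis using False by (auto simp: min_def odd_iff_mod_2_eq_one)
    qed
  qed
  also have "\<dots> \<longleftrightarrow> {i. i \<le> 2 * n \<and> even i} \<subseteq> zeros P \<union> zeros Q"
    by (auto simp: zeros_def len)
  finally show ?thesis .
qed

text \<open>A path has trivial meet with \<open>P\<close> iff it touches the axis on all of
  \<open>S\<close>, and the distance path of \<open>S\<close> is the greatest such path. Including
  \<open>0\<close> and \<open>2 * n\<close> in \<open>S\<close> excludes no path, as all Dyck paths
  vanish there. The zeros are recorded so that the pseudocomplement can be taken again.\<close>

lemma pseudocomplement_dyck_lattice:
  assumes P: "P \<in> dyck_paths n"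
  defines "S \<equiv> {i. i \<le> 2 * n \<and> even i \<and> i \<notin> zeros P} \<union> {0, 2 * n}"
  shows "pseudocomplement (dyck_lattice n) P \<in> dyck_paths n"
    and "i \<le> 2 * n \<Longrightarrow> height (pseudocomplement (dyck_lattice n) P) i = dist_to S i"
    and "zeros (pseudocomplement (dyck_lattice n) P) = S"
proof -
  let ?L = "dyck_lattice n"
  interpret lattice ?L by (rule lattice_dyck_lattice)
  define A where "A = {Z \<in> carrier ?L. P \<sqinter>\<^bsub>?L\<^esub> Z \<sqsubseteq>\<^bsub>?L\<^esub> \<bottom>\<^bsub>?L\<^esub>}"
  have A_iff: "Z \<in> A \<longleftrightarrow> Z \<in> dyck_paths n \<and> S \<subseteq> zeros Z" for Z
  proof (cases "Z \<in> dyck_paths n")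
    case True
    then have "Z \<in> A \<longleftrightarrow> P \<sqinter>\<^bsub>?L\<^esub> Z \<sqsubseteq>\<^bsub>?L\<^esub> \<bottom>\<^bsub>?L\<^esub>" by (simp add: A_def dyck_lattice_def)
    also have "\<dots> \<longleftrightarrow> S \<subseteq> zeros Z"
      using ends_in_zeros[OF True] unfolding meet_le_bottom_iff[OF P True] by (auto simp: S_def)
    finally show ?thesis using True by simp
  qed (simp add: A_def dyck_lattice_def)
  have S: "S \<subseteq> {..2 * n}" "S \<noteq> {}" "0 \<in> S" "2 * n \<in> S" "\<And>s. s \<in> S \<Longrightarrow> even s"
    by (auto simp: S_def)
  obtain M where M: "M \<in> dyck_paths n" "\<And>i. i \<le> 2 * n \<Longrightarrow> height M i = dist_to S i"
    using dist_to_path[OF S(1,5,3,4)] by blast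
  have zM: "zeros M = S" using zeros_dist_to[OF M S(1,2)] .
  have "M \<in> A" using A_iff M zM by simp
  moreover have "Z \<sqsubseteq>\<^bsub>?L\<^esub> M" if "Z \<in> A" for Z
    using that M S(2) height_le_dist_to[of _ Z S]
    by (auto simp: A_iff dyck_lattice_def weakly_below_def dyck_paths_def)
  ultimately have lub: "least ?L M (Upper ?L A)"
    using M by (auto simp: least_def Upper_def A_def dyck_lattice_def)
  \<comment> \<open>The join is a choice among least upper bounds, and \<open>M\<close>, the
    greatest element of \<open>A\<close>, is the only one.\<close>
  have "pseudocomplement ?L P = (SOME x. least ?L x (Upper ?L A))"
    by (simp add: pseudocomplement_def rel_pseudocomplement_def sup_def A_def)
  also have "\<dots> = M"
    using lub least_unique by (blast intro: some_equality)
  finally have "pseudocomplement ?L P = M" .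
  with M zM show "pseudocomplement ?L P \<in> dyck_paths n"
    and "i \<le> 2 * n \<Longrightarrow> height (pseudocomplement ?L P) i = dist_to S i"
    and "zeros (pseudocomplement ?L P) = S" by auto
qed

theorem proposition2p2:
  fixes n :: nat and P :: "step list"
  assumes "n \<ge> 1" and "P \<in> dyck_paths n"
  shows "regular_element (dyck_lattice n) P \<longleftrightarrow> (\<forall>i j. is_factor P i j \<longrightarrow> is_pyramid P i j)"
proof -
  let ?L = "dyck_lattice n"
  define Q where "Q = pseudocomplement ?L P"
  define R where "R = pseudocomplement ?L Q"
  note P = assms(2)
  have Q: "Q \<in> dyck_paths n"
    and zQ: "zeros Q = {i. i \<le> 2 * n \<and> even i \<and> i \<notin> zeros P} \<union> {0, 2 * n}"
    unfolding Q_def using pseudocomplement_dyck_lattice[OF P] by blast+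
  \<comment> \<open>Complementing twice within the even abscissas restores \<open>zeros P\<close>:
    the points \<open>0\<close> and \<open>2 * n\<close>, adjoined both times, belong to it
    anyway.\<close>
  have "zeros P \<subseteq> {i. i \<le> 2 * n \<and> even i}"
    using P even_zeros[of _ P] by (auto simp: zeros_def dyck_paths_def)
  with ends_in_zeros[OF P]
  have "{i. i \<le> 2 * n \<and> even i \<and> i \<notin> zeros Q} \<union> {0, 2 * n} = zeros P"
    unfolding zQ by auto
  then have R: "R \<in> dyck_paths n" "\<And>i. i \<le> 2 * n \<Longrightarrow> height R i = dist_to (zeros P) i"
    unfolding R_def using pseudocomplement_dyck_lattice(1,2)[OF Q] by auto
  have "regular_element ?L P \<longleftrightarrow> P = R"
    using P by (simp add: regular_element_def R_def Q_def dyck_lattice_def)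
  also have "\<dots> \<longleftrightarrow> (\<forall>i\<le>2 * n. height P i = dist_to (zeros P) i)"
    using P R height_eqI[of P R] by (auto simp: dyck_paths_def)
  finally show ?thesis using height_eq_dist_to_zeros_iff[OF P] by simp
qed

end
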